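(* Let $X=\{0,1\}^{\mathbb N}$, let $G$ be a locally compact second countable abelian group, and let $\Gamma=\langle\delta_1,\dots,\delta_n,\dots\rangle$ be the group of Borel automorphisms of $X$ generated by the maps $\delta_n$, $n\in\mathbb N$, where $(\delta_nx)_i=x_i$ for $i\ne n$ and $(\delta_nx)_n=x_n+1 \pmod 2$. Then for every cocycle $c:\Gamma\times X\to G$ there exists a sequence of Borel functions $(f_n:X\to G)_{n\in\mathbb N}$ such that, for all $n\in\mathbb N$ and $x\in X$, $$c(\delta_n,x)=x_1f_1(\delta_nx)+\dots+x_{n-1}f_{n-1}(\delta_nx)+(-1)^{x_n}f_n(x)-x_{n-1}f_{n-1}(x)-\dots-x_1f_1(x),\qquad( * )$$ where the function $f_n$ is invariant with respect to $\delta_1,\delta_2,\dots,\delta_n$ for each $n\in\mathbb N$. Conversely, let $(f_n:X\to G)_{n\in\mathbb N}$ be a sequence of Borel maps such that each $f_n$ is invariant with respect to $\delta_1,\dots,\delta_n$. Then $(f_n)_{n\in\mathbb N}$ generates a cocycle $c:\Gamma\times X\to G$ according to $( * )$, i.e. there is a cocycle $c$ satisfying $( * )$ for all $n\in\mathbb N$ and $x\in X$.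
   Context: $X=\{0,1\}^{\mathbb N}$ has the Borel $\sigma$-algebra generated by cylinder sets; points are $x=(x_1,x_2,\dots)$ with $x_i\in\{0,1\}$. $G$ is written additively, and for $g\in G$, $x_ig$ means $0$ if $x_i=0$ and $g$ if $x_i=1$; $(-1)^{x_n}g$ means $g$ if $x_n=0$ and $-g$ if $x_n=1$. A function $f$ on $X$ is invariant with respect to $\delta_j$ if $f(\delta_jx)=f(x)$ for all $x\in X$. A cocycle is a Borel function $c:\Gamma\times X\to G$ with $c(\gamma_1\gamma_2,x)=c(\gamma_1,\gamma_2x)+c(\gamma_2,x)$ for all $\gamma_1,\gamma_2\in\Gamma$, $x\in X$, and $c(\mathbb 1,x)=0$, where $\mathbb 1$ is the identity map. *)

theory Defs
  imports "HOL-Analysis.Analysis" "HOL-Algebra.Generated_Groups"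
begin

text \<open>
  Coordinates are indexed from 0 rather than from 1: the point $(x_1, x_2, \dots)$ is the function
  \<open>x\<close> with \<open>x i\<close> standing for $x_{i+1}$, and \<open>delta n\<close>, \<open>f n\<close> stand for $\delta_{n+1}$, $f_{n+1}$.
  The digits 0 and 1 are \<open>False\<close> and \<open>True\<close>, so adding 1 modulo 2 is negation.
\<close>

type_synonym point = "nat \<Rightarrow> bool"

text \<open>The product \<open>\<sigma>\<close>-algebra is the one generated by the cylinder sets.\<close>

definition X :: "point measure" where
  "X = (\<Pi>\<^sub>M i\<in>UNIV. count_space UNIV)"

definition borel_aut :: "(point \<Rightarrow> point) monoid" where
  "borel_aut =
     \<lparr>carrier = {\<gamma>. bij \<gamma> \<and> \<gamma> \<in> measurable X X \<and> inv_into UNIV \<gamma> \<in> measurable X X},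
      mult = (\<circ>),
      one = id\<rparr>"

definition delta :: "nat \<Rightarrow> point \<Rightarrow> point" where
  "delta n x = x(n := \<not> x n)"

definition Gamma :: "(point \<Rightarrow> point) set" where
  "Gamma = generate borel_aut (range delta)"

text \<open>
  \<^const>\<open>Gamma\<close> is a countable group and carries the discrete \<open>\<sigma>\<close>-algebra. Only the values of a
  cocycle on \<open>Gamma \<times> UNIV\<close> matter.
\<close>

definition cocycle :: "((point \<Rightarrow> point) \<times> point \<Rightarrow> 'g::topological_ab_group_add) \<Rightarrow> bool" where
  "cocycle c \<longleftrightarrow>
     c \<in> borel_measurable (count_space Gamma \<Otimes>\<^sub>M X) \<and>
     (\<forall>\<gamma>\<^sub>1\<in>Gamma. \<forall>\<gamma>\<^sub>2\<in>Gamma. \<forall>x. c (\<gamma>\<^sub>1 \<circ> \<gamma>\<^sub>2, x) = c (\<gamma>\<^sub>1, \<gamma>\<^sub>2 x) + c (\<gamma>\<^sub>2, x)) \<and>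
     (\<forall>x. c (id, x) = 0)"

definition invariant :: "(point \<Rightarrow> 'g) \<Rightarrow> nat \<Rightarrow> bool" where
  "invariant f j \<longleftrightarrow> (\<forall>x. f (delta j x) = f x)"

text \<open>\<open>digit_mult d g\<close> is $d g$ and \<open>digit_sign d g\<close> is $(-1)^d g$, for a digit \<open>d\<close>.\<close>

definition digit_mult :: "bool \<Rightarrow> 'g::ab_group_add \<Rightarrow> 'g" where
  "digit_mult d g = (if d then g else 0)"

definition digit_sign :: "bool \<Rightarrow> 'g::ab_group_add \<Rightarrow> 'g" where
  "digit_sign d g = (if d then - g else g)"


lemma space_X: "space X = UNIV"
  by (simp add: X_def space_PiM)

lemma group_borel_aut: "group borel_aut"
proof (rule groupI)
  fix \<gamma>\<^sub>1 \<gamma>\<^sub>2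
  assume "\<gamma>\<^sub>1 \<in> carrier borel_aut" "\<gamma>\<^sub>2 \<in> carrier borel_aut"
  then show "\<gamma>\<^sub>1 \<otimes>\<^bsub>borel_aut\<^esub> \<gamma>\<^sub>2 \<in> carrier borel_aut"
    by (auto simp: borel_aut_def o_inv_distrib intro: bij_comp measurable_comp)
next
  fix \<gamma>
  assume \<gamma>: "\<gamma> \<in> carrier borel_aut"
  then have "inv_into UNIV \<gamma> \<in> carrier borel_aut"
    by (auto simp: borel_aut_def bij_imp_bij_inv inv_inv_eq)
  moreover from \<gamma> have "inv_into UNIV \<gamma> \<otimes>\<^bsub>borel_aut\<^esub> \<gamma> = \<one>\<^bsub>borel_aut\<^esub>"
    by (auto simp: borel_aut_def bij_is_inj)
  ultimately show "\<exists>\<gamma>'\<in>carrier borel_aut. \<gamma>' \<otimes>\<^bsub>borel_aut\<^esub> \<gamma> = \<one>\<^bsub>borel_aut\<^esub>"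
    by blast
qed (auto simp: borel_aut_def o_assoc)

lemma delta_delta: "delta n \<circ> delta n = id"
  by (auto simp: delta_def fun_eq_iff)

lemma delta_measurable: "delta n \<in> measurable X X"
proof -
  have "(\<lambda>x. delta n x i) \<in> measurable X (count_space UNIV)" for i
  proof (cases "i = n")
    case True
    have "(\<lambda>x. \<not> x n) \<in> measurable X (count_space UNIV)"
      unfolding X_def by measurable
    then show ?thesis using True by (simp add: delta_def)
  next
    case False
    then show ?thesis by (simp add: delta_def X_def)
  qed
  then show ?thesis
    unfolding X_def by (intro measurable_PiM_single') (auto simp: X_def[symmetric] space_X)
qed

lemma delta_carrier: "delta n \<in> carrier borel_aut"
proof -
  have "bij (delta n)" and "inv_into UNIV (delta n) = delta n"
    using delta_delta by (auto intro: o_bij inv_unique_comp)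
  then show ?thesis by (simp add: borel_aut_def delta_measurable)
qed

end

theory Submission imports Defs begin

text \<open>
  Formally, a sequence \<open>f\<close> as in the statement makes \<open>c\<close> the coboundary of
  $S = \sum_i x_i f_i(x)$. This infinite sum has no meaning, but for \<open>\<gamma>\<close> in the group only finitely
  many terms of $S(\gamma x) - S(x)$ survive, because the later \<open>f i\<close> are \<open>\<gamma>\<close>-invariant. This gives
  the converse direction. Given a cocycle \<open>c\<close>, let \<open>f n x\<close> be the value of \<open>c (delta n, _)\<close> at \<open>x\<close>
  with the digits up to \<open>n\<close> erased. Restoring the digits one at a time shows that the partial sum
  of \<open>S\<close> at \<open>x\<close> is the value of \<open>c\<close> along the way from the erased point back to \<open>x\<close>.
\<close>

section \<open>The group \<open>Gamma\<close> as the finite flips\<close>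

definition flip :: "nat set \<Rightarrow> point \<Rightarrow> point" where
  "flip A x = (\<lambda>i. x i \<noteq> (i \<in> A))"

lemma flip_empty: "flip {} = id"
  by (simp add: flip_def fun_eq_iff)

lemma flip_comp: "flip A \<circ> flip B = flip (sym_diff A B)"
  by (auto simp: flip_def fun_eq_iff)

lemma delta_eq_flip: "delta n = flip {n}"
  by (auto simp: flip_def delta_def fun_eq_iff)

lemma flip_insert: "i \<notin> A \<Longrightarrow> flip (insert i A) = delta i \<circ> flip A"
  by (auto simp: flip_def delta_def fun_eq_iff)

lemma Gamma_subset_carrier: "Gamma \<subseteq> carrier borel_aut"
  unfolding Gamma_def
  by (intro group.generate_incl group_borel_aut) (auto intro: delta_carrier)

lemma Gamma_measurable: "\<gamma> \<in> Gamma \<Longrightarrow> \<gamma> \<in> measurable X X"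
  using Gamma_subset_carrier by (auto simp: borel_aut_def)

lemma id_Gamma: "id \<in> Gamma"
  using generate.one[of borel_aut "range delta"] by (simp add: Gamma_def borel_aut_def)

lemma delta_Gamma: "delta n \<in> Gamma"
  unfolding Gamma_def by (rule generate.incl) auto

lemma comp_Gamma: "\<gamma> \<in> Gamma \<Longrightarrow> \<gamma>' \<in> Gamma \<Longrightarrow> \<gamma> \<circ> \<gamma>' \<in> Gamma"
  using generate.eng[of \<gamma> borel_aut "range delta" \<gamma>'] by (simp add: Gamma_def borel_aut_def)

text \<open>By \<open>flip_comp\<close>, finite flips are closed under composition, and each
  generator is its own inverse, so they contain all of \<open>Gamma\<close>. Conversely,
  \<open>flip_insert\<close> builds any finite flip from generators, one index at a time.\<close>

lemma Gamma_eq_flip: "Gamma = flip ` {A. finite A}"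
proof (intro equalityI subsetI)
  fix \<gamma> assume "\<gamma> \<in> Gamma"
  then show "\<gamma> \<in> flip ` {A. finite A}"
    unfolding Gamma_def
  proof (induction rule: generate.induct)
    case one
    then show ?case by (auto simp: borel_aut_def flip_empty[symmetric])
  next
    case (incl h)
    then show ?case by (auto simp: delta_eq_flip)
  next
    case (inv h)
    then obtain n where h: "h = delta n" by auto
    have "inv\<^bsub>borel_aut\<^esub> h = h"
      using delta_delta[of n] delta_carrier[of n]
      by (intro group.inv_equality[OF group_borel_aut]) (auto simp: h borel_aut_def)
    then show ?case by (auto simp: h delta_eq_flip)
  next
    case (eng h1 h2)
    then obtain A B where "finite A" "finite B" "h1 = flip A" "h2 = flip B" by auto
    then have "h1 \<otimes>\<^bsub>borel_aut\<^esub> h2 = flip (sym_diff A B)" "finite (sym_diff A B)"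
      by (simp_all add: borel_aut_def flip_comp)
    then show ?case by blast
  qed
next
  fix \<gamma> assume "\<gamma> \<in> flip ` {A. finite A}"
  then obtain A where "finite A" and \<gamma>: "\<gamma> = flip A" by auto
  from this(1) have "flip A \<in> Gamma"
  proof (induction A)
    case empty
    show ?case by (simp only: flip_empty id_Gamma)
  next
    case (insert i A)
    then show ?case by (simp only: flip_insert comp_Gamma delta_Gamma not_False_eq_True)
  qed
  then show "\<gamma> \<in> Gamma" by (simp add: \<gamma>)
qed

lemma flip_Gamma: "finite A \<Longrightarrow> flip A \<in> Gamma"
  by (simp add: Gamma_eq_flip)

lemma countable_Gamma: "countable Gamma"
proof -
  have "countable {A :: nat set. finite A}"
    using countable_Collect_finite .
  then show ?thesis unfolding Gamma_eq_flip by (rule countable_image)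
qed

lemma invariant_flip:
  assumes "finite A" "\<And>j. j \<in> A \<Longrightarrow> invariant f j"
  shows "f (flip A x) = f x"
  using assms
  by (induction A arbitrary: x) (auto simp: flip_empty flip_insert invariant_def)

section \<open>Partial sums of the formal series\<close>

definition transfer :: "(nat \<Rightarrow> point \<Rightarrow> 'g::ab_group_add) \<Rightarrow> nat \<Rightarrow> point \<Rightarrow> 'g" where
  "transfer f n x = (\<Sum>i<n. digit_mult (x i) (f i x))"

text \<open>The right-hand side is that of the required formula. Digits below \<open>n\<close> are
  untouched by \<open>delta n\<close>; the term at \<open>n\<close> appears or disappears when the
  digit there changes, which produces the sign.\<close>

lemma transfer_diff_delta:
  assumes "invariant (f n) n"
  shows "transfer f (Suc n) (delta n x) - transfer f (Suc n) x =
    (\<Sum>i<n. digit_mult (x i) (f i (delta n x))) + digit_sign (x n) (f n x)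
    - (\<Sum>i<n. digit_mult (x i) (f i x))"
proof -
  have "(\<Sum>i<n. digit_mult (delta n x i) (f i (delta n x))) =
    (\<Sum>i<n. digit_mult (x i) (f i (delta n x)))"
    by (rule sum.cong) (auto simp: delta_def)
  moreover have "f n (delta n x) = f n x" using assms by (simp add: invariant_def)
  moreover have "delta n x n = (\<not> x n)" by (simp add: delta_def)
  ultimately show ?thesis
    by (simp add: transfer_def digit_mult_def digit_sign_def algebra_simps)
qed

text \<open>The term at any index \<open>M \<ge> N\<close> cancels: the flip leaves digit
  \<open>M\<close> alone, and \<open>f M\<close> is invariant under each \<open>delta j\<close> with
  \<open>j \<in> A\<close>, as \<open>j < N\<close>. So the differences stabilise, which gives the
  divergent expression a meaning.\<close>

lemma transfer_diff_flip:
  assumes inv: "\<And>n j. j \<le> n \<Longrightarrow> invariant (f n) j"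
    and A: "A \<subseteq> {..<N}" and "N \<le> M"
  shows "transfer f M (flip A x) - transfer f M x = transfer f N (flip A x) - transfer f N x"
  using \<open>N \<le> M\<close>
proof (induction M rule: dec_induct)
  case base
  show ?case ..
next
  case (step M)
  have "f M (flip A x) = f M x"
    using A step.hyps by (intro invariant_flip finite_subset[OF A]) (auto intro!: inv)
  moreover have "flip A x M = x M"
    using A step.hyps by (auto simp: flip_def)
  ultimately show ?case using step.IH by (simp add: transfer_def)
qed

lemma digit_measurable: "(\<lambda>x. x i) \<in> measurable X (count_space UNIV)"
  unfolding X_def by measurable

lemma transfer_measurable:
  fixes f :: "nat \<Rightarrow> point \<Rightarrow> 'g::{topological_ab_group_add, second_countable_topology}"
  assumes "\<And>n. f n \<in> borel_measurable X"
  shows "transfer f n \<in> borel_measurable X"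
proof (induction n)
  case 0
  then show ?case by (simp add: transfer_def)
next
  case (Suc n)
  have "(\<lambda>x. digit_mult (x n) (f n x)) \<in> borel_measurable X"
    unfolding digit_mult_def
    by (intro measurable_If assms) (use digit_measurable[of n] in \<open>auto simp: pred_def\<close>)
  with Suc have "(\<lambda>x. transfer f n x + digit_mult (x n) (f n x)) \<in> borel_measurable X"
    by (rule borel_measurable_add)
  then show ?case by (simp add: transfer_def)
qed

text \<open>Second countability identifies the Borel sets of the square of the group with the
  product \<sigma>-algebra, so continuity of subtraction yields measurability.\<close>

lemma borel_measurable_diff_group:
  fixes f g :: "'a \<Rightarrow> 'g::{topological_group_add, second_countable_topology}"
  assumes "f \<in> borel_measurable M" "g \<in> borel_measurable M"
  shows "(\<lambda>x. f x - g x) \<in> borel_measurable M"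
  using assms by (rule borel_measurable_continuous_Pair) (intro continuous_intros)

section \<open>From a cocycle to the functions\<close>

definition erase :: "nat \<Rightarrow> point \<Rightarrow> point" where
  "erase n x = (\<lambda>i. n \<le> i \<and> x i)"

lemma erase_measurable: "erase n \<in> measurable X X"
proof -
  have "(\<lambda>x. erase n x i) \<in> measurable X (count_space UNIV)" for i
    using digit_measurable[of i] by (cases "n \<le> i") (auto simp: erase_def)
  then have "(\<lambda>x i. erase n x i) \<in> measurable X (\<Pi>\<^sub>M i\<in>UNIV. count_space UNIV)"
    by (intro measurable_PiM_single') simp_all
  then show ?thesis by (simp flip: X_def)
qed

lemma erase_delta: "j < n \<Longrightarrow> erase n (delta j x) = erase n x"
  by (auto simp: erase_def delta_def fun_eq_iff)

lemma erase_Suc: "erase (Suc n) x = (if x n then delta n (erase n x) else erase n x)"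
  by (auto simp: erase_def delta_def fun_eq_iff Suc_le_eq order.strict_iff_order)

lemma flip_erase: "flip {i. i < n \<and> x i} (erase n x) = x"
  by (auto simp: flip_def erase_def fun_eq_iff)

lemma cocycle_section_measurable:
  assumes "cocycle c" "\<gamma> \<in> Gamma"
  shows "(\<lambda>x. c (\<gamma>, x)) \<in> borel_measurable X"
  using assms by (intro measurable_Pair2[of c "count_space Gamma"]) (auto simp: cocycle_def)

lemma cocycle_comp:
  "cocycle c \<Longrightarrow> \<gamma> \<in> Gamma \<Longrightarrow> \<gamma>' \<in> Gamma \<Longrightarrow> c (\<gamma> \<circ> \<gamma>', x) = c (\<gamma>, \<gamma>' x) + c (\<gamma>', x)"
  by (simp add: cocycle_def)

text \<open>Erasing \<open>Suc n\<close> digits removes digit \<open>n\<close> too, so that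
  invariance under \<open>delta n\<close> itself holds.\<close>

definition erased_values ::
  "((point \<Rightarrow> point) \<times> point \<Rightarrow> 'g) \<Rightarrow> nat \<Rightarrow> point \<Rightarrow> 'g" where
  "erased_values c n x = c (delta n, erase (Suc n) x)"

lemma erased_values_invariant: "j \<le> n \<Longrightarrow> invariant (erased_values c n) j"
  by (simp add: invariant_def erased_values_def erase_delta)

lemma erased_values_measurable:
  assumes "cocycle c"
  shows "erased_values c n \<in> borel_measurable X"
  unfolding erased_values_def
  by (rule measurable_compose[OF erase_measurable cocycle_section_measurable[OF assms delta_Gamma]])

text \<open>The way from \<open>erase (Suc n) x\<close> to \<open>x\<close> passes through
  \<open>erase n x\<close>. If digit \<open>n\<close> is set, this first step is
  \<open>delta n\<close> and contributes \<open>erased_values c n x\<close>; otherwise the two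
  points coincide and nothing is added.\<close>

lemma cocycle_flip_erase:
  assumes c: "cocycle c"
  shows "c (flip {i. i < n \<and> x i}, erase n x) = transfer (erased_values c) n x"
proof (induction n)
  case 0
  have "c (flip {}, erase 0 x) = 0"
    using c unfolding cocycle_def flip_empty by blast
  then show ?case by (simp add: transfer_def)
next
  case (Suc n)
  show ?case
  proof (cases "x n")
    case False
    then have "{i. i < Suc n \<and> x i} = {i. i < n \<and> x i}"
      by (auto simp: less_Suc_eq)
    then show ?thesis
      using Suc False by (simp add: transfer_def digit_mult_def erase_Suc)
  next
    case True
    let ?A = "{i. i < n \<and> x i}"
    \<comment> \<open>Digit \<open>n\<close> is restored first, so \<open>delta n\<close> is the
      right factor of the composition.\<close>
    have "sym_diff ?A {n} = {i. i < Suc n \<and> x i}"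
      using True by (auto simp: less_Suc_eq)
    then have "c (flip {i. i < Suc n \<and> x i}, erase (Suc n) x) =
        c (flip ?A \<circ> delta n, erase (Suc n) x)"
      by (simp only: delta_eq_flip flip_comp)
    also have "\<dots> = c (flip ?A, delta n (erase (Suc n) x)) + c (delta n, erase (Suc n) x)"
      by (rule cocycle_comp[OF c flip_Gamma delta_Gamma]) simp
    also have "delta n (erase (Suc n) x) = erase n x"
      using True delta_delta[of n] by (simp add: erase_Suc fun_eq_iff)
    finally show ?thesis
      using Suc True by (simp add: transfer_def digit_mult_def erased_values_def)
  qed
qed

text \<open>Both \<open>x\<close> and \<open>delta n x\<close> have the same erased point. Going
  from it to \<open>delta n x\<close> by way of \<open>x\<close> and applying the cocycle identity
  isolates \<open>c (delta n, x)\<close>.\<close>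

lemma cocycle_delta_eq_transfer_diff:
  assumes c: "cocycle c"
  shows "c (delta n, x) =
    transfer (erased_values c) (Suc n) (delta n x) - transfer (erased_values c) (Suc n) x"
proof -
  let ?A = "{i. i < Suc n \<and> x i}"
  have "{i. i < Suc n \<and> delta n x i} = sym_diff {n} ?A"
    by (auto simp: delta_def split: if_splits)
  then have flip_delta: "flip {i. i < Suc n \<and> delta n x i} = delta n \<circ> flip ?A"
    by (simp only: delta_eq_flip flip_comp)
  have "transfer (erased_values c) (Suc n) (delta n x) =
      c (flip {i. i < Suc n \<and> delta n x i}, erase (Suc n) (delta n x))"
    by (rule cocycle_flip_erase[OF c, symmetric])
  also have "\<dots> = c (delta n \<circ> flip ?A, erase (Suc n) x)"
    by (simp only: flip_delta erase_delta lessI)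
  also have "\<dots> = c (delta n, flip ?A (erase (Suc n) x)) + c (flip ?A, erase (Suc n) x)"
    by (rule cocycle_comp[OF c delta_Gamma flip_Gamma]) simp
  also have "\<dots> = c (delta n, x) + transfer (erased_values c) (Suc n) x"
    by (simp only: flip_erase cocycle_flip_erase[OF c])
  finally show ?thesis by simp
qed

section \<open>From the functions to a cocycle\<close>

definition flip_bound :: "(point \<Rightarrow> point) \<Rightarrow> nat" where
  "flip_bound \<gamma> = (LEAST N. \<exists>A\<subseteq>{..<N}. \<gamma> = flip A)"

text \<open>A finite set of indices is bounded, so the least bound is attained. Outside
  \<open>Gamma\<close> no bound exists and \<open>flip_bound\<close> is an unspecified number, but
  cocycles are only evaluated on \<open>Gamma\<close>.\<close>

lemma Gamma_flip_bound:
  assumes "\<gamma> \<in> Gamma"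
  obtains A where "A \<subseteq> {..<flip_bound \<gamma>}" "\<gamma> = flip A"
proof -
  from assms obtain A where "finite A" "\<gamma> = flip A"
    by (auto simp: Gamma_eq_flip)
  then have "\<exists>N. \<exists>A\<subseteq>{..<N}. \<gamma> = flip A"
    using finite_nat_bounded[of A] by (auto simp: lessThan_def)
  from LeastI_ex[OF this] that show ?thesis
    unfolding flip_bound_def by blast
qed

definition transfer_cocycle ::
  "(nat \<Rightarrow> point \<Rightarrow> 'g::ab_group_add) \<Rightarrow> (point \<Rightarrow> point) \<times> point \<Rightarrow> 'g" where
  "transfer_cocycle f = (\<lambda>(\<gamma>, x).
     transfer f (flip_bound \<gamma>) (\<gamma> x) - transfer f (flip_bound \<gamma>) x)"

text \<open>Allowing any longer truncation lets several group elements be compared at one common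
  length.\<close>

lemma transfer_cocycle_eq:
  assumes inv: "\<And>n j. j \<le> n \<Longrightarrow> invariant (f n) j"
    and \<gamma>: "\<gamma> \<in> Gamma" "flip_bound \<gamma> \<le> N"
  shows "transfer_cocycle f (\<gamma>, x) = transfer f N (\<gamma> x) - transfer f N x"
proof -
  obtain A where A: "A \<subseteq> {..<flip_bound \<gamma>}" "\<gamma> = flip A"
    using Gamma_flip_bound[OF \<gamma>(1)] .
  have "transfer f N (flip A x) - transfer f N x =
    transfer f (flip_bound \<gamma>) (flip A x) - transfer f (flip_bound \<gamma>) x"
    by (rule transfer_diff_flip) (use inv A \<gamma> in auto)
  then show ?thesis by (simp add: transfer_cocycle_def flip: A(2))
qed

lemma flip_bound_delta: "flip_bound (delta n) \<le> Suc n"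
  unfolding flip_bound_def by (rule Least_le) (auto simp: delta_eq_flip)

lemma cocycle_transfer_cocycle:
  fixes f :: "nat \<Rightarrow> point \<Rightarrow> 'g::{topological_ab_group_add, second_countable_topology}"
  assumes f: "\<And>n. f n \<in> borel_measurable X"
    and inv: "\<And>n j. j \<le> n \<Longrightarrow> invariant (f n) j"
  shows "cocycle (transfer_cocycle f)"
  unfolding cocycle_def
proof (intro conjI ballI allI)
  show "transfer_cocycle f \<in> borel_measurable (count_space Gamma \<Otimes>\<^sub>M X)"
  \<comment> \<open>As \<open>Gamma\<close> is countable and discrete, joint measurability reduces
    to that of each section.\<close>
  proof (rule measurable_pair_measure_countable1[OF countable_Gamma])
    fix \<gamma> assume "\<gamma> \<in> Gamma"
    then show "(\<lambda>x. transfer_cocycle f (\<gamma>, x)) \<in> borel_measurable X"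
      unfolding transfer_cocycle_def prod.case
      by (intro borel_measurable_diff_group transfer_measurable f
          measurable_compose[OF Gamma_measurable])
  qed
next
  fix \<gamma> \<gamma>' x assume G: "\<gamma> \<in> Gamma" "\<gamma>' \<in> Gamma"
  \<comment> \<open>With one truncation for all three elements, the cocycle identity is a
    telescoping sum through \<open>\<gamma>' x\<close>.\<close>
  define N where "N = Max {flip_bound \<gamma>, flip_bound \<gamma>', flip_bound (\<gamma> \<circ> \<gamma>')}"
  have N: "flip_bound \<gamma> \<le> N" "flip_bound \<gamma>' \<le> N" "flip_bound (\<gamma> \<circ> \<gamma>') \<le> N"
    by (auto simp: N_def)
  note eq = transfer_cocycle_eq[of f _ N, OF inv]
  show "transfer_cocycle f (\<gamma> \<circ> \<gamma>', x) =
      transfer_cocycle f (\<gamma>, \<gamma>' x) + transfer_cocycle f (\<gamma>', x)"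
    using eq[OF _ G(1) N(1)] eq[OF _ G(2) N(2)] eq[OF _ comp_Gamma[OF G] N(3)] by simp
next
  fix x show "transfer_cocycle f (id, x) = 0"
    by (simp add: transfer_cocycle_def)
qed

theorem proposition5p1:
  assumes "locally_compact_space
    (euclidean :: 'g::{topological_ab_group_add, second_countable_topology} topology)"
  shows
    "(\<forall>c :: (point \<Rightarrow> point) \<times> point \<Rightarrow> 'g. cocycle c \<longrightarrow>
        (\<exists>f :: nat \<Rightarrow> point \<Rightarrow> 'g.
           (\<forall>n. f n \<in> borel_measurable X) \<and>
           (\<forall>n x. c (delta n, x) =
              (\<Sum>i<n. digit_mult (x i) (f i (delta n x))) + digit_sign (x n) (f n x)
              - (\<Sum>i<n. digit_mult (x i) (f i x))) \<and>
           (\<forall>n. \<forall>j\<le>n. invariant (f n) j)))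
     \<and>
     (\<forall>f :: nat \<Rightarrow> point \<Rightarrow> 'g.
        (\<forall>n. f n \<in> borel_measurable X) \<and> (\<forall>n. \<forall>j\<le>n. invariant (f n) j) \<longrightarrow>
        (\<exists>c :: (point \<Rightarrow> point) \<times> point \<Rightarrow> 'g. cocycle c \<and>
           (\<forall>n x. c (delta n, x) =
              (\<Sum>i<n. digit_mult (x i) (f i (delta n x))) + digit_sign (x n) (f n x)
              - (\<Sum>i<n. digit_mult (x i) (f i x)))))"
proof (intro conjI allI impI)
  fix c :: "(point \<Rightarrow> point) \<times> point \<Rightarrow> 'g"
  assume c: "cocycle c"
  show "\<exists>f. (\<forall>n. f n \<in> borel_measurable X) \<and>
      (\<forall>n x. c (delta n, x) =
         (\<Sum>i<n. digit_mult (x i) (f i (delta n x))) + digit_sign (x n) (f n x)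
         - (\<Sum>i<n. digit_mult (x i) (f i x))) \<and>
      (\<forall>n. \<forall>j\<le>n. invariant (f n) j)"
    \<comment> \<open>The increment of the partial sum of length \<open>Suc n\<close> links the two
      equations: it equals \<open>c (delta n, x)\<close> and also the required right-hand
      side.\<close>
    using erased_values_measurable[OF c] erased_values_invariant
      trans[OF cocycle_delta_eq_transfer_diff[OF c]
        transfer_diff_delta[OF erased_values_invariant[OF order_refl]]]
    by (intro exI[of _ "erased_values c"]) blast
next
  fix f :: "nat \<Rightarrow> point \<Rightarrow> 'g"
  assume "(\<forall>n. f n \<in> borel_measurable X) \<and> (\<forall>n. \<forall>j\<le>n. invariant (f n) j)"
  then have f: "\<And>n. f n \<in> borel_measurable X" and inv: "\<And>n j. j \<le> n \<Longrightarrow> invariant (f n) j"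
    by auto
  have "transfer_cocycle f (delta n, x) =
      transfer f (Suc n) (delta n x) - transfer f (Suc n) x" for n x
    by (rule transfer_cocycle_eq[OF inv delta_Gamma flip_bound_delta])
  from this transfer_diff_delta[OF inv[OF order_refl]]
  have "transfer_cocycle f (delta n, x) =
      (\<Sum>i<n. digit_mult (x i) (f i (delta n x))) + digit_sign (x n) (f n x)
      - (\<Sum>i<n. digit_mult (x i) (f i x))" for n x
    by (rule trans)
  then show "\<exists>c. cocycle c \<and>
      (\<forall>n x. c (delta n, x) =
         (\<Sum>i<n. digit_mult (x i) (f i (delta n x))) + digit_sign (x n) (f n x)
         - (\<Sum>i<n. digit_mult (x i) (f i x)))"
    using cocycle_transfer_cocycle[of f, OF f inv] by blast
qed

end
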